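(* Let $V_0>0$, $0\le v_w<V_0$ and $\phi(V_0)>0$ be real constants, and set $P_0=\phi(V_0)V_0$ and $P_1=\phi(V_0)v_w$. Fix boundary configurations $(x_i,y_i,\theta_i),(x_j,y_j,\theta_j)\in\mathbb{R}^3$. Let $\mathcal{A}$ be the set of all admissible trajectories (paths) from $(x_i,y_i,\theta_i)$ to $(x_j,y_j,\theta_j)$, that is, all tuples $(T,x,y,\theta,u)$ with free terminal time $T>0$, an integrable control $u:[0,T]\to\mathbb{R}$, and absolutely continuous functions $x,y,\theta:[0,T]\to\mathbb{R}$ satisfying, for almost every $t\in[0,T]$, $$\dot x(t)=V_0\cos\theta(t)+v_w,\qquad \dot y(t)=V_0\sin\theta(t),\qquad \dot\theta(t)=u(t),$$ together with $$(x(0),y(0),\theta(0))=(x_i,y_i,\theta_i),\qquad (x(T),y(T),\theta(T))=(x_j,y_j,\theta_j).$$ Then minimum energy paths and minimum time paths are the same: an element of $\mathcal{A}$ minimizes the energy $$\int_0^T\bigl(P_0+P_1\cos\theta(t)\bigr)\,dt$$ over $\mathcal{A}$ if and only if it minimizes the travel time $$\int_0^T dt=T$$ over $\mathcal{A}$.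
   Context: A vehicle moves in the plane with constant speed $V_0$ relative to a medium (e.g. air) that itself moves with constant speed $v_w$ in the positive $x$-direction; $v_w=0$ is the case of a still medium. The assumption $v_w<V_0$ means the medium does not overpower the vehicle. Here $(x,y)$ is the vehicle's position in the ground frame, $\theta$ its heading angle relative to the direction of the medium's velocity, and $u$ its unconstrained turn rate. The dissipative (drag) force has magnitude $\phi(V_0)$, a positive constant depending only on $V_0$, and the power dissipated at heading $\theta$ is $P(\theta)=P_0+P_1\cos\theta$. The energy of a path is the integral of the power over $[0,T]$. The terminal time $T$ is a free variable in both minimization problems. *)

theory Defs
  imports "HOL-Analysis.Analysis"
begin

(* Absolute continuity in the epsilon-delta sense.  A division D consists of finitely many
   nonempty compact intervals K = {Inf K..Sup K} with pairwise disjoint interiors; degenerate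
   intervals are allowed but contribute 0 to both sums. *)
definition absolutely_continuous_on :: "real set \<Rightarrow> (real \<Rightarrow> real) \<Rightarrow> bool" where
  "absolutely_continuous_on S f \<longleftrightarrow>
     (\<forall>\<epsilon>>0. \<exists>\<delta>>0. \<forall>D. D division_of \<Union>D \<and> \<Union>D \<subseteq> S \<and> (\<Sum>K\<in>D. Sup K - Inf K) < \<delta>
        \<longrightarrow> (\<Sum>K\<in>D. \<bar>f (Sup K) - f (Inf K)\<bar>) < \<epsilon>)"

(* The functions are total, but only their restrictions to {0..terminal_time p} enter the
   admissibility conditions and the cost functionals below. *)
record trajectory =
  terminal_time :: real
  xpos :: "real \<Rightarrow> real"
  ypos :: "real \<Rightarrow> real"
  heading :: "real \<Rightarrow> real"
  turn_rate :: "real \<Rightarrow> real"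

(* The derivatives are taken within {0..T}, so that they do not see values outside the interval;
   at interior points they are the ordinary two-sided derivatives. *)
definition admissible ::
  "real \<Rightarrow> real \<Rightarrow> real \<times> real \<times> real \<Rightarrow> real \<times> real \<times> real \<Rightarrow> trajectory set" where
  "admissible V\<^sub>0 v\<^sub>w c\<^sub>i c\<^sub>j =
     {p. let T = terminal_time p; x = xpos p; y = ypos p; \<theta> = heading p; u = turn_rate p in
        T > 0 \<and>
        set_integrable lebesgue {0..T} u \<and>
        absolutely_continuous_on {0..T} x \<and>
        absolutely_continuous_on {0..T} y \<and>
        absolutely_continuous_on {0..T} \<theta> \<and>
        (AE t\<in>{0..T} in lebesgue.
           (x has_real_derivative V\<^sub>0 * cos (\<theta> t) + v\<^sub>w) (at t within {0..T}) \<and>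
           (y has_real_derivative V\<^sub>0 * sin (\<theta> t)) (at t within {0..T}) \<and>
           (\<theta> has_real_derivative u t) (at t within {0..T})) \<and>
        (x 0, y 0, \<theta> 0) = c\<^sub>i \<and>
        (x T, y T, \<theta> T) = c\<^sub>j}"

definition energy :: "real \<Rightarrow> real \<Rightarrow> trajectory \<Rightarrow> real" where
  "energy P\<^sub>0 P\<^sub>1 p =
     (LINT t:{0..terminal_time p}|lebesgue. P\<^sub>0 + P\<^sub>1 * cos (heading p t))"

definition travel_time :: "trajectory \<Rightarrow> real" where
  "travel_time p = (LINT t:{0..terminal_time p}|lebesgue. 1)"

lemma travel_time_eq: "terminal_time p \<ge> 0 \<Longrightarrow> travel_time p = terminal_time p"
  by (simp add: travel_time_def set_lebesgue_integral_def)

end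

theory Submission
  imports Defs
begin

text \<open>
  The energy of a path depends only on its duration and on the prescribed endpoints.  The
  horizontal velocity \<open>V\<^sub>0 * cos \<theta> + v\<^sub>w\<close> and the power
  \<open>\<phi> V\<^sub>0 * (V\<^sub>0 + v\<^sub>w * cos \<theta>)\<close> are both affine in \<open>cos \<theta>\<close>, and integrating the former
  must give the fixed displacement \<open>x\<^sub>j - x\<^sub>i\<close>.  This determines the integral of
  \<open>cos \<theta>\<close> from \<open>T\<close> alone, and substituting it into the energy yields
  \<open>(\<phi> V\<^sub>0 / V\<^sub>0) * ((V\<^sub>0\<^sup>2 - v\<^sub>w\<^sup>2) * T + v\<^sub>w * (x\<^sub>j - x\<^sub>i))\<close>.  Since \<open>v\<^sub>w < V\<^sub>0\<close>, the
  coefficient of \<open>T\<close> is positive: energy is a strictly increasing function of travel time on the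
  admissible set, so the two problems have the same minimizers.

  The analytic content is the fundamental theorem of calculus for absolutely continuous functions
  (\<open>absolutely_continuous_has_integral_derivative\<close>), which justifies integrating the horizontal
  velocity although it is only known almost everywhere.  The gauge integral allows a direct proof:
  at points of differentiability the derivative controls the increments, and around the exceptional
  null set a gauge confined to an open set of small measure leaves the increments to absolute
  continuity.
\<close>

section \<open>The fundamental theorem of calculus for absolutely continuous functions\<close>

lemma real_division_member:
  fixes D :: "real set set"
  assumes "D division_of S" and "K \<in> D"
  obtains u v where "u \<le> v" "K = {u..v}" "Inf K = u" "Sup K = v"
proof -
  obtain u v where "K = cbox u v" "K \<noteq> {}"
    using division_ofD(3,4)[OF assms] by blast
  then show thesis
    using that[of u v] by auto
qed

lemma sum_lengths_le_measure:
  fixes D :: "real set set"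
  assumes D: "D division_of S" and "S \<subseteq> U" and "U \<in> lmeasurable"
  shows "(\<Sum>K\<in>D. Sup K - Inf K) \<le> measure lebesgue U"
proof -
  have "((\<lambda>x. 1::real) has_integral (Sup K - Inf K)) K" if K: "K \<in> D" for K
  proof -
    obtain u v where uv: "u \<le> v" "K = {u..v}" "Inf K = u" "Sup K = v"
      using real_division_member[OF D K] .
    show ?thesis
      using has_integral_const_real[of "1::real" u v] uv by simp
  qed
  then have "((\<lambda>x. 1::real) has_integral (\<Sum>K\<in>D. Sup K - Inf K)) S"
    using D by (intro has_integral_combine_division) auto
  moreover have "((\<lambda>x. 1::real) has_integral measure lebesgue U) U"
  proof -
    have "indicat_real U = (\<lambda>x. if x \<in> U then 1 else 0)"
      by (auto simp: fun_eq_iff)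
    with \<open>U \<in> lmeasurable\<close> show ?thesis
      by (simp only: lmeasurable_iff_has_integral has_integral_restrict_UNIV)
  qed
  ultimately show ?thesis
    using has_integral_subset_le[OF \<open>S \<subseteq> U\<close>, of "\<lambda>x. 1"] by simp
qed

text \<open>
  Absolute continuity speaks of divisions, Riemann sums of tagged ones.  The same interval may
  occur with several tags, but only if it is degenerate, and then it adds nothing to the variation.
\<close>

lemma sum_increments_tagged_eq_division:
  fixes f :: "real \<Rightarrow> real"
  assumes q: "q tagged_division_of S"
  shows "(\<Sum>(x,K)\<in>q. \<bar>f (Sup K) - f (Inf K)\<bar>) = (\<Sum>K\<in>snd ` q. \<bar>f (Sup K) - f (Inf K)\<bar>)"
proof -
  have "\<bar>f (Sup K) - f (Inf K)\<bar> = 0"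
    if xK: "(x,K) \<in> q" and yK: "(y,K) \<in> q" and "x \<noteq> y" for x y K
  proof -
    have "K \<in> snd ` q"
      using xK by (metis imageI snd_conv)
    then obtain u v where uv: "u \<le> v" "K = {u..v}" "Inf K = u" "Sup K = v"
      by (rule real_division_member[OF division_of_tagged_division[OF q]])
    have "interior K = {}"
      using tagged_division_ofD(5)[OF q xK yK] \<open>x \<noteq> y\<close> by auto
    then show ?thesis
      using uv by auto
  qed
  then have "(\<Sum>K\<in>snd ` q. \<bar>f (Sup K) - f (Inf K)\<bar>)
      = sum ((\<lambda>K. \<bar>f (Sup K) - f (Inf K)\<bar>) \<circ> snd) q"
    using tagged_division_ofD(1)[OF q] by (intro sum.reindex_nontrivial) (auto, metis)
  then show ?thesis
    by (simp add: case_prod_unfold)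
qed

text \<open>
  The derivative is stated to vanish on the exceptional set \<open>N\<close>, so that intervals
  tagged in \<open>N\<close> contribute only the increments of \<open>f\<close>.  This costs no generality, because the
  integrand may be changed on a null set.
\<close>

lemma absolutely_continuous_has_integral_derivative_zero_on_null:
  fixes f f' :: "real \<Rightarrow> real"
  assumes "a < b" and ac: "absolutely_continuous_on {a..b} f" and "negligible N"
    and f': "\<And>x. x \<in> {a..b} - N \<Longrightarrow> (f has_real_derivative f' x) (at x within {a..b})"
    and zero: "\<And>x. x \<in> N \<Longrightarrow> f' x = 0"
  shows "(f' has_integral (f b - f a)) {a..b}"
  unfolding has_integral_factor_content_real
proof safe
  fix e :: real
  assume "e > 0"
  \<comment> \<open>Half of the allowed error goes to the increments tagged in \<open>N\<close>, half to the derivative.\<close>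
  have "e / 2 * (b - a) > 0"
    using \<open>e > 0\<close> \<open>a < b\<close> by simp
  then obtain \<delta> where "\<delta> > 0" and \<delta>: "\<And>D. D division_of \<Union>D \<Longrightarrow> \<Union>D \<subseteq> {a..b} \<Longrightarrow>
      (\<Sum>K\<in>D. Sup K - Inf K) < \<delta> \<Longrightarrow> (\<Sum>K\<in>D. \<bar>f (Sup K) - f (Inf K)\<bar>) < e / 2 * (b - a)"
    using ac unfolding absolutely_continuous_on_def by meson
  obtain U where "open U" "N \<subseteq> U" and U: "U \<in> lmeasurable" "measure lebesgue U < \<delta>"
  proof -
    obtain U where U: "open U" "N \<subseteq> U" "U - N \<in> lmeasurable"
      "emeasure lebesgue (U - N) < ennreal \<delta>"
      using sets_lebesgue_outer_open[OF negligible_imp_sets[OF \<open>negligible N\<close>] \<open>\<delta> > 0\<close>] .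
    have "U = (U - N) \<union> N"
      using U by auto
    then have "U \<in> lmeasurable"
      using fmeasurable.Un[OF U(3) negligible_imp_measurable[OF \<open>negligible N\<close>]] by simp
    moreover have "measure lebesgue U < \<delta>"
    proof -
      have "measure lebesgue U = measure lebesgue (U - N)"
        using \<open>negligible N\<close> \<open>U \<in> lmeasurable\<close>
        by (simp add: measure_Diff_null_set negligible_iff_null_sets fmeasurableD)
      also have "\<dots> < \<delta>"
        using U(3,4) \<open>\<delta> > 0\<close> by (simp add: emeasure_eq_measure2 ennreal_less_iff)
      finally show ?thesis .
    qed
    ultimately show thesis
      using that U by blast
  qed
  have "\<exists>d>0. x \<in> {a..b} - N \<longrightarrow>
      (\<forall>y\<in>{a..b}. \<bar>y - x\<bar> < d \<longrightarrow> \<bar>f y - f x - (y - x) * f' x\<bar> \<le> e / 2 * \<bar>y - x\<bar>)" for x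
  proof (cases "x \<in> {a..b} - N")
    case True
    have "(f has_derivative (*) (f' x)) (at x within {a..b})"
      using f'[OF True] by (simp add: has_field_derivative_def)
    with \<open>e > 0\<close> show ?thesis
      unfolding has_derivative_within_alt by (auto simp: mult.commute dest!: spec[of _ "e / 2"])
  next
    case False
    then show ?thesis
      by (meson zero_less_one)
  qed
  then obtain d where "\<And>x. d x > 0" and d: "\<And>x y. x \<in> {a..b} - N \<Longrightarrow> y \<in> {a..b} \<Longrightarrow>
      \<bar>y - x\<bar> < d x \<Longrightarrow> \<bar>f y - f x - (y - x) * f' x\<bar> \<le> e / 2 * \<bar>y - x\<bar>"
    by metis
  define \<gamma> where "\<gamma> x = (if x \<in> N then U else ball x (d x))" for x
  have "gauge \<gamma>"
    using \<open>\<And>x. d x > 0\<close> \<open>open U\<close> \<open>N \<subseteq> U\<close> by (auto simp: gauge_def \<gamma>_def)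
  show "\<exists>\<gamma>. gauge \<gamma> \<and> (\<forall>p. p tagged_division_of {a..b} \<and> \<gamma> fine p \<longrightarrow>
    norm ((\<Sum>(x,K)\<in>p. measure lborel K *\<^sub>R f' x) - (f b - f a)) \<le> e * measure lborel {a..b})"
  proof (intro exI conjI allI impI)
    show "gauge \<gamma>" by fact
  next
    fix p
    assume "p tagged_division_of {a..b} \<and> \<gamma> fine p"
    then have p: "p tagged_division_of {a..b}" and fine: "\<gamma> fine p"
      by auto
    have fin: "finite p"
      using p by blast
    have telescope: "b - a = (\<Sum>(x,K)\<in>p. Sup K - Inf K)"
      "f b - f a = (\<Sum>(x,K)\<in>p. f (Sup K) - f (Inf K))"
      using additive_tagged_division_1[OF _ p, of "\<lambda>x. x"]
        additive_tagged_division_1[OF _ p, of f] \<open>a < b\<close> by auto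
    let ?q = "{xK \<in> p. fst xK \<in> N}"
    have tagged_in_N: "(\<Sum>(x,K)\<in>?q. \<bar>f (Sup K) - f (Inf K)\<bar>) < e / 2 * (b - a)"
    proof -
      have "?q tagged_partial_division_of {a..b}"
        using tagged_partial_division_subset[of p "{a..b}" ?q] p
        unfolding tagged_division_of_def by blast
      then have q: "?q tagged_division_of \<Union>(snd ` ?q)"
        by (rule tagged_partial_division_of_Union_self)
      have D: "snd ` ?q division_of \<Union>(snd ` ?q)"
        using division_of_tagged_division[OF q] .
      have "\<Union>(snd ` ?q) \<subseteq> U \<inter> {a..b}"
      proof (rule Union_least)
        fix K assume "K \<in> snd ` ?q"
        then obtain x where "(x,K) \<in> p" "x \<in> N"
          by auto
        then show "K \<subseteq> U \<inter> {a..b}"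
          using fineD[OF fine, of x K] tagged_division_ofD(3)[OF p, of x K] by (simp add: \<gamma>_def)
      qed
      then have sub: "\<Union>(snd ` ?q) \<subseteq> U" "\<Union>(snd ` ?q) \<subseteq> {a..b}"
        by (simp_all only: le_inf_iff)
      have "(\<Sum>K\<in>snd ` ?q. Sup K - Inf K) < \<delta>"
        using sum_lengths_le_measure[OF D sub(1) U(1)] U(2) by simp
      from \<delta>[OF D sub(2) this] show ?thesis
        unfolding sum_increments_tagged_eq_division[OF q] .
    qed
    have local_error: "\<bar>measure lborel K * f' x - (f (Sup K) - f (Inf K))\<bar>
        \<le> e / 2 * (Sup K - Inf K) + (if x \<in> N then \<bar>f (Sup K) - f (Inf K)\<bar> else 0)"
      if xK: "(x,K) \<in> p" for x K
    proof -
      have "K \<in> snd ` p"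
        using xK by (metis imageI snd_conv)
      then obtain u v where uv: "u \<le> v" "K = {u..v}" "Inf K = u" "Sup K = v"
        by (rule real_division_member[OF division_of_tagged_division[OF p]])
      have x: "x \<in> {u..v}" and sub: "{u..v} \<subseteq> {a..b}"
        using tagged_division_ofD(2,3)[OF p xK] uv by auto
      show ?thesis
      proof (cases "x \<in> N")
        case True
        then show ?thesis
          using uv zero \<open>e > 0\<close> by (simp add: abs_minus_commute)
      next
        case False
        have "{u..v} \<subseteq> ball x (d x)"
          using fineD[OF fine xK] False uv by (simp add: \<gamma>_def)
        moreover have "u \<in> {u..v}" "v \<in> {u..v}"
          using uv by auto
        ultimately have near: "u \<in> ball x (d x)" "v \<in> ball x (d x)"
          by blast+
        have "\<bar>f u - f x - (u - x) * f' x\<bar> \<le> e / 2 * \<bar>u - x\<bar>"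
          "\<bar>f v - f x - (v - x) * f' x\<bar> \<le> e / 2 * \<bar>v - x\<bar>"
          using near x sub False uv by (intro d; auto simp: dist_real_def)+
        moreover have "e / 2 * \<bar>u - x\<bar> + e / 2 * \<bar>v - x\<bar> = e / 2 * (v - u)"
          using x by (simp add: field_simps)
        moreover have "(v - u) * f' x - (f v - f u)
            = (f u - f x - (u - x) * f' x) - (f v - f x - (v - x) * f' x)"
          by (simp add: algebra_simps)
        ultimately have "\<bar>(v - u) * f' x - (f v - f u)\<bar> \<le> e / 2 * (v - u)"
          by linarith
        then show ?thesis
          using uv False by simp
      qed
    qed
    have "(\<Sum>(x,K)\<in>p. measure lborel K *\<^sub>R f' x) - (f b - f a)
        = (\<Sum>(x,K)\<in>p. measure lborel K * f' x - (f (Sup K) - f (Inf K)))"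
      by (simp add: telescope sum_subtractf case_prod_unfold)
    also have "norm \<dots> \<le> (\<Sum>(x,K)\<in>p. e / 2 * (Sup K - Inf K)
        + (if x \<in> N then \<bar>f (Sup K) - f (Inf K)\<bar> else 0))"
      using local_error by (intro sum_norm_le) auto
    also have "\<dots> = e / 2 * (b - a) + (\<Sum>(x,K)\<in>?q. \<bar>f (Sup K) - f (Inf K)\<bar>)"
      unfolding telescope(1) using fin
      by (simp add: case_prod_unfold sum.distrib sum_distrib_left sum.inter_filter)
    also have "\<dots> \<le> e * (b - a)"
      using tagged_in_N by simp
    finally show "norm ((\<Sum>(x,K)\<in>p. measure lborel K *\<^sub>R f' x) - (f b - f a)) \<le> e * measure lborel {a..b}"
      using \<open>a < b\<close> by simp
  qed
qed

theorem absolutely_continuous_has_integral_derivative: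
  fixes f f' :: "real \<Rightarrow> real"
  assumes "a \<le> b" and ac: "absolutely_continuous_on {a..b} f"
    and deriv: "AE x\<in>{a..b} in lebesgue. (f has_real_derivative f' x) (at x within {a..b})"
  shows "(f' has_integral (f b - f a)) {a..b}"
proof (cases "a = b")
  case True
  then show ?thesis
    using has_integral_refl(2)[of f' a] by simp
next
  case False
  define N where "N = {x \<in> {a..b}. \<not> (f has_real_derivative f' x) (at x within {a..b})}"
  have N: "negligible N"
    using deriv by (auto simp: N_def negligible_iff_null_sets completion.AE_iff_null_sets
        null_sets_completion_subset Collect_neg_eq[symmetric] Collect_conj_eq[symmetric])
  let ?g = "\<lambda>x. if x \<in> N then 0 else f' x"
  have "(?g has_integral (f b - f a)) {a..b}"
    using ac N assms(1) False
    by (intro absolutely_continuous_has_integral_derivative_zero_on_null[of _ _ _ N])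
      (auto simp: N_def)
  then show ?thesis
    by (rule has_integral_spike[OF N, rotated]) auto
qed

section \<open>Energy as a function of travel time\<close>

text \<open>
  This is where the common endpoints enter: the vehicle can change its average \<open>cos \<theta>\<close> only by
  changing the duration of the path.
\<close>

lemma has_integral_cos_heading:
  assumes q: "q \<in> admissible V v (x\<^sub>i, y\<^sub>i, \<theta>\<^sub>i) (x\<^sub>j, y\<^sub>j, \<theta>\<^sub>j)" and "V \<noteq> 0"
  shows "((\<lambda>t. cos (heading q t)) has_integral (x\<^sub>j - x\<^sub>i - v * terminal_time q) / V)
    {0..terminal_time q}"
proof -
  let ?T = "terminal_time q"
  have T: "?T > 0" and ac: "absolutely_continuous_on {0..?T} (xpos q)"
    and ends: "xpos q 0 = x\<^sub>i" "xpos q ?T = x\<^sub>j"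
    using q by (simp_all add: admissible_def Let_def)
  have "AE t\<in>{0..?T} in lebesgue.
      (xpos q has_real_derivative V * cos (heading q t) + v) (at t within {0..?T})"
    using q unfolding admissible_def Let_def by (auto elim!: eventually_mono)
  from absolutely_continuous_has_integral_derivative[OF _ ac this] T ends
  have "((\<lambda>t. V * cos (heading q t) + v) has_integral x\<^sub>j - x\<^sub>i) {0..?T}"
    by simp
  from has_integral_diff[OF this has_integral_const_real[of v 0 ?T]] T
  have "((\<lambda>t. V * cos (heading q t)) has_integral x\<^sub>j - x\<^sub>i - v * ?T) {0..?T}"
    by (simp add: mult.commute)
  from has_integral_divide[OF this, of V] \<open>V \<noteq> 0\<close> show ?thesis
    by simp
qed

lemma energy_eq_affine_terminal_time:
  assumes q: "q \<in> admissible V v (x\<^sub>i, y\<^sub>i, \<theta>\<^sub>i) (x\<^sub>j, y\<^sub>j, \<theta>\<^sub>j)" and "V \<noteq> 0"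
  shows "energy P Q q = (P - Q * v / V) * terminal_time q + Q * (x\<^sub>j - x\<^sub>i) / V"
proof -
  let ?T = "terminal_time q" and ?power = "\<lambda>t. P + Q * cos (heading q t)"
  have T: "?T > 0"
    using q by (simp add: admissible_def Let_def)
  have power: "(?power has_integral P * ?T + Q * ((x\<^sub>j - x\<^sub>i - v * ?T) / V)) {0..?T}"
    using has_integral_add[OF has_integral_const_real[of P 0 ?T]
        has_integral_mult_right[OF has_integral_cos_heading[OF assms], of Q]] T
    by (simp add: mult.commute)
  \<comment> \<open>Boundedness of the power turns its gauge integral into the Lebesgue integral.\<close>
  have "\<bar>?power t\<bar> \<le> \<bar>P\<bar> + \<bar>Q\<bar>" for t
  proof -
    have "\<bar>Q * cos (heading q t)\<bar> \<le> \<bar>Q\<bar> * 1"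
      unfolding abs_mult by (intro mult_left_mono) auto
    then show ?thesis by linarith
  qed
  then have "?power absolutely_integrable_on {0..?T}"
    using power by (intro absolutely_integrable_integrable_bound[where g = "\<lambda>_. \<bar>P\<bar> + \<bar>Q\<bar>"]) auto
  then have "energy P Q q = integral {0..?T} ?power"
    unfolding energy_def by (rule set_lebesgue_integral_eq_integral(2))
  also have "\<dots> = P * ?T + Q * ((x\<^sub>j - x\<^sub>i - v * ?T) / V)"
    using power by (rule integral_unique)
  finally show ?thesis
    by (simp add: algebra_simps diff_divide_distrib add_divide_distrib)
qed

theorem theorem1:
  fixes V\<^sub>0 v\<^sub>w P\<^sub>0 P\<^sub>1 :: real and \<phi> :: "real \<Rightarrow> real"
    and x\<^sub>i y\<^sub>i \<theta>\<^sub>i x\<^sub>j y\<^sub>j \<theta>\<^sub>j :: real and p :: trajectory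
  assumes "V\<^sub>0 > 0" and "0 \<le> v\<^sub>w" and "v\<^sub>w < V\<^sub>0" and "\<phi> V\<^sub>0 > 0"
    and "P\<^sub>0 = \<phi> V\<^sub>0 * V\<^sub>0" and "P\<^sub>1 = \<phi> V\<^sub>0 * v\<^sub>w"
    and "p \<in> admissible V\<^sub>0 v\<^sub>w (x\<^sub>i, y\<^sub>i, \<theta>\<^sub>i) (x\<^sub>j, y\<^sub>j, \<theta>\<^sub>j)"
  shows "is_arg_min (energy P\<^sub>0 P\<^sub>1)
           (\<lambda>q. q \<in> admissible V\<^sub>0 v\<^sub>w (x\<^sub>i, y\<^sub>i, \<theta>\<^sub>i) (x\<^sub>j, y\<^sub>j, \<theta>\<^sub>j)) p \<longleftrightarrow>
         is_arg_min travel_time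
           (\<lambda>q. q \<in> admissible V\<^sub>0 v\<^sub>w (x\<^sub>i, y\<^sub>i, \<theta>\<^sub>i) (x\<^sub>j, y\<^sub>j, \<theta>\<^sub>j)) p"
proof -
  let ?A = "admissible V\<^sub>0 v\<^sub>w (x\<^sub>i, y\<^sub>i, \<theta>\<^sub>i) (x\<^sub>j, y\<^sub>j, \<theta>\<^sub>j)"
  define c where "c = P\<^sub>0 - P\<^sub>1 * v\<^sub>w / V\<^sub>0"
  have "c = \<phi> V\<^sub>0 * ((V\<^sub>0 - v\<^sub>w) * (V\<^sub>0 + v\<^sub>w)) / V\<^sub>0"
    using assms(1,5,6) by (simp add: c_def field_simps)
  then have "c > 0"
    using assms(1-4) by simp
  have less_iff: "energy P\<^sub>0 P\<^sub>1 q < energy P\<^sub>0 P\<^sub>1 p \<longleftrightarrow> travel_time q < travel_time p"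
    if "q \<in> ?A" for q
  proof -
    have "terminal_time q > 0" "terminal_time p > 0"
      using that assms(7) by (simp_all add: admissible_def Let_def)
    then show ?thesis
      using energy_eq_affine_terminal_time[OF that] energy_eq_affine_terminal_time[OF assms(7)]
        assms(1) \<open>c > 0\<close>
      by (simp add: travel_time_eq c_def[symmetric])
  qed
  then show ?thesis
    by (auto simp: is_arg_min_def)
qed

end
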